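(* The optimal OLD-density of the infinite triangular grid is $4/13$. That is, every open-locating-dominating set of the infinite triangular grid has density at least $4/13$, and there exists an open-locating-dominating set of the infinite triangular grid with density exactly $4/13$.
   Context: The infinite triangular grid is the infinite $6$-regular graph whose vertices are the points of the triangular lattice in the plane (e.g. $\{a(1,0)+b(1/2,\sqrt{3}/2): a,b\in\mathbb{Z}\}$), two vertices being adjacent when at Euclidean distance $1$. For a vertex $v$ of a graph $G$, $N(v)$ denotes its open neighborhood (the set of vertices adjacent to $v$). A set $S\subseteq V(G)$ is an open-locating-dominating set (OLD-set) if (i) $N(v)\cap S\neq\emptyset$ for every vertex $v\in V(G)$, and (ii) $N(v)\cap S\neq N(w)\cap S$ for all distinct vertices $v,w\in V(G)$. For an OLD-set $S$ of an infinite graph $G$ and a vertex $v$, let $N_k[v]$ be the set of vertices of $G$ at distance at most $k$ from $v$; the density of $S$ is $\limsup_{k\to\infty} |N_k[v]\cap S|/|N_k[v]|$ (the paper takes the minimum over choices of $v$). The optimal OLD-density of $G$ is the minimum of the density over all OLD-sets $S$ of $G$. *)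

theory Defs
  imports "HOL-Analysis.Analysis"
begin

text \<open>
  A graph is given by its vertex set \<open>V\<close> and its adjacency relation \<open>E\<close> (symmetric and
  irreflexive, contained in \<open>V \<times> V\<close>).  The open neighborhood of \<open>v\<close> is then the relational
  image \<open>E `` {v}\<close>, and \<open>(u, w) \<in> E ^^ n\<close> says that there is a walk of length \<open>n\<close> from \<open>u\<close> to \<open>w\<close>.
\<close>

definition OLD_set :: "'a set \<Rightarrow> 'a rel \<Rightarrow> 'a set \<Rightarrow> bool" where
  "OLD_set V E S \<longleftrightarrow> S \<subseteq> V \<and>
     (\<forall>v\<in>V. E `` {v} \<inter> S \<noteq> {}) \<and>
     (\<forall>v\<in>V. \<forall>w\<in>V. v \<noteq> w \<longrightarrow> E `` {v} \<inter> S \<noteq> E `` {w} \<inter> S)"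

text \<open>Length of a shortest walk; it is \<open>\<infinity>\<close> if there is none.\<close>

definition graph_dist :: "'a rel \<Rightarrow> 'a \<Rightarrow> 'a \<Rightarrow> enat" where
  "graph_dist E u w = (INF n\<in>{n. (u, w) \<in> E ^^ n}. enat n)"

definition graph_cball :: "'a set \<Rightarrow> 'a rel \<Rightarrow> 'a \<Rightarrow> nat \<Rightarrow> 'a set" where
  "graph_cball V E v k = {w \<in> V. graph_dist E v w \<le> enat k}"

text \<open>
  The minimum over the choice of the center \<open>v\<close> is written as an infimum, with which it agrees
  whenever it exists; in the triangular grid the upper limit does not depend on \<open>v\<close>.
  Meaningful for locally finite graphs, where all the balls are finite.
\<close>

definition set_density :: "'a set \<Rightarrow> 'a rel \<Rightarrow> 'a set \<Rightarrow> ereal" where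
  "set_density V E S =
     (INF v\<in>V. limsup (\<lambda>k. ereal (real (card (graph_cball V E v k \<inter> S))
                                  / real (card (graph_cball V E v k)))))"

text \<open>An infimum again; attainment has to be claimed separately.\<close>

definition optimal_OLD_density :: "'a set \<Rightarrow> 'a rel \<Rightarrow> ereal" where
  "optimal_OLD_density V E = (INF S\<in>{S. OLD_set V E S}. set_density V E S)"

definition tri_verts :: "(real \<times> real) set" where
  "tri_verts = {of_int a *\<^sub>R (1, 0) + of_int b *\<^sub>R (1 / 2, sqrt 3 / 2) | a b :: int. True}"

text \<open>The metric on \<^typ>\<open>real \<times> real\<close> is the Euclidean one.\<close>

definition tri_edges :: "(real \<times> real) rel" where
  "tri_edges = {(u, v). u \<in> tri_verts \<and> v \<in> tri_verts \<and> dist u v = 1}"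

end

theory Submission
  imports Defs "HOL-Real_Asymp.Real_Asymp"
begin

text \<open>
  Let \<open>deg u\<close> be the number of neighbors of \<open>u\<close> in \<open>S\<close>. Since every \<open>deg u\<close> is positive and the
  vertices with \<open>deg u = 1\<close> inject into the set of their unique neighbors (the owners),
  the degree sum gives, per unit of area and with \<open>\<rho>\<close> the density of \<open>S\<close> and \<open>\<omega>\<close> that of the owners,
  \<open>2 + excess \<le> 6 \<rho> + \<omega>\<close>, where the excess is the density of \<open>\<Sum>(deg u - 2)\<close> over the vertices with
  \<open>deg u \<ge> 3\<close>. Discharging shows \<open>\<omega> \<le> 2 * excess\<close>, so that \<open>2 \<le> 6 \<rho> + \<omega> / 2 \<le> 13 / 2 * \<rho>\<close>.

  For the discharging, every \<open>v \<in> S\<close> has a neighbor \<open>x \<in> S\<close>, and the two common neighbors of \<open>v\<close> and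
  \<open>x\<close> are separated, so one of them has degree at least 3. An owner \<open>v\<close> claims a unit only from
  vertices \<open>h\<close> that arise in this way, and \<open>h\<close> can afford \<open>2 * (deg h - 2)\<close> units. This suffices
  unless \<open>deg h = 3\<close> and all three neighbors of \<open>h\<close> in \<open>S\<close> claim. They are then consecutive on the
  hexagon around \<open>h\<close>, and either one of them is served by a vertex that is not of this kind,
  or two of them share a second such vertex.

  The value is attained by the points with \<open>(a + 3 * b) mod 13 \<in> {0, 2, 5, 7}\<close>, in coordinates
  with respect to the basis of the lattice.
\<close>

subsection \<open>Directions in the triangular lattice\<close>

definition dirs :: "(int \<times> int) set" where
  "dirs = {(1, 0), (0, 1), (-1, 1), (-1, 0), (0, -1), (1, -1)}"

definition nb :: "int \<times> int \<Rightarrow> (int \<times> int) set" where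
  "nb p = (+) p ` dirs"

text \<open>Two directions at 60 degrees, in either orientation. The hexagon around a point is then,
  in cyclic order, \<open>e, f, f - e, - e, - f, e - f\<close>, so an argument in these terms covers
  all 12 symmetric positions at once.\<close>

definition hexbasis :: "int \<times> int \<Rightarrow> int \<times> int \<Rightarrow> bool" where
  "hexbasis e f \<longleftrightarrow> e \<in> dirs \<and> f \<in> dirs \<and> f - e \<in> dirs"

lemma finite_nb [simp]: "finite (nb p)"
  by (simp add: nb_def dirs_def)

lemma card_nb: "card (nb p) = 6"
  unfolding nb_def by (subst card_image) (auto simp: dirs_def)

lemma in_nb_iff: "q \<in> nb p \<longleftrightarrow> q - p \<in> dirs"
proof -
  have "q \<in> (+) p ` dirs \<longleftrightarrow> (\<exists>d\<in>dirs. d = q - p)"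
    by (force simp: image_iff algebra_simps)
  then show ?thesis
    by (simp add: nb_def)
qed

lemma uminus_dirs: "- d \<in> dirs \<longleftrightarrow> d \<in> dirs"
  by (cases d) (auto simp: dirs_def)

lemma nb_sym: "q \<in> nb p \<longleftrightarrow> p \<in> nb q"
  using uminus_dirs[of "q - p"] by (simp add: in_nb_iff)

lemma int_pair_eq_0: "(a :: int, b :: int) = 0 \<longleftrightarrow> a = 0 \<and> b = 0"
  by (simp add: zero_prod_def)

lemma hexbasis_cases:
  assumes "hexbasis e f"
  shows "(e, f) \<in> {((1,0),(0,1)), ((0,1),(-1,1)), ((-1,1),(-1,0)), ((-1,0),(0,-1)), ((0,-1),(1,-1)), ((1,-1),(1,0)),
                   ((0,1),(1,0)), ((-1,1),(0,1)), ((-1,0),(-1,1)), ((0,-1),(-1,0)), ((1,-1),(0,-1)), ((1,0),(1,-1))}"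
proof -
  have "\<forall>e\<in>dirs. \<forall>f\<in>dirs. f - e \<in> dirs \<longrightarrow>
    (e, f) \<in> {((1,0),(0,1)), ((0,1),(-1,1)), ((-1,1),(-1,0)), ((-1,0),(0,-1)), ((0,-1),(1,-1)), ((1,-1),(1,0)),
               ((0,1),(1,0)), ((-1,1),(0,1)), ((-1,0),(-1,1)), ((0,-1),(-1,0)), ((1,-1),(0,-1)), ((1,0),(1,-1))}"
    unfolding dirs_def by (simp add: int_pair_eq_0)
  then show ?thesis
    using assms by (simp add: hexbasis_def)
qed

lemma dirs_hexbasis:
  assumes "hexbasis e f"
  shows "dirs = {e, f, f - e, - e, - f, e - f}"
  using hexbasis_cases[OF assms] by (elim insertE emptyE) (auto simp: dirs_def int_pair_eq_0)

lemma nb_hexbasis: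
  assumes "hexbasis e f"
  shows "nb p = {p + e, p + f, p + (f - e), p - e, p - f, p + (e - f)}"
  unfolding nb_def dirs_hexbasis[OF assms] by (auto simp: algebra_simps)

lemma hexbasis_exists:
  assumes "e \<in> dirs"
  obtains f where "hexbasis e f"
proof -
  have "\<exists>f\<in>dirs. f - e \<in> dirs"
    using assms by (auto simp: dirs_def)
  then show ?thesis
    using assms that by (auto simp: hexbasis_def)
qed

text \<open>The symmetries used below: the reflection fixing \<open>f\<close>, the swap of
  \<open>e\<close> and \<open>f\<close>, the reflection fixing \<open>e\<close>, the half turn, and
  the rotation by 120 degrees.\<close>

lemma hexbasis_mirror:
  assumes "hexbasis e f"
  shows "hexbasis (f - e) f" "hexbasis f e" "hexbasis e (e - f)" "hexbasis (- e) (- f)" "hexbasis (f - e) (- e)"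
  using assms uminus_dirs[of e] uminus_dirs[of f] uminus_dirs[of "f - e"]
  by (simp_all add: hexbasis_def)

lemma hexbasis_neq:
  assumes "hexbasis e f"
  shows "e \<noteq> 0" "f \<noteq> 0" "e \<noteq> f" "e + f \<noteq> 0" "e \<noteq> f + f" "f \<noteq> e + e" "e \<noteq> - f" "f \<noteq> - e" "e + e \<noteq> 0" "e + e \<noteq> f + f"
proof -
  have "e \<noteq> 0 \<and> f \<noteq> 0 \<and> e \<noteq> f \<and> e + f \<noteq> 0 \<and> e \<noteq> f + f \<and> f \<noteq> e + e \<and> e \<noteq> - f \<and> f \<noteq> - e \<and> e + e \<noteq> 0 \<and>
      e + e \<noteq> f + f"
    using hexbasis_cases[OF assms] by (elim insertE emptyE) (auto simp: int_pair_eq_0)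
  then show "e \<noteq> 0" "f \<noteq> 0" "e \<noteq> f" "e + f \<noteq> 0" "e \<noteq> f + f" "f \<noteq> e + e" "e \<noteq> - f" "f \<noteq> - e" "e + e \<noteq> 0" "e + e \<noteq> f + f"
    by blast+
qed

text \<open>The directions \<open>e\<close> and \<open>f - e\<close> are 120 degrees apart: the ends
  of three consecutive points on a hexagon are not adjacent.\<close>

lemma hexbasis_far:
  assumes "hexbasis e f"
  shows "f - e - e \<notin> dirs"
  using hexbasis_cases[OF assms] by (elim insertE emptyE) (auto simp: dirs_def int_pair_eq_0)

lemma hexbasis_unique:
  assumes "hexbasis e f" "hexbasis e g"
  shows "g = f \<or> g = e - f"
  using hexbasis_cases[OF assms(1)] hexbasis_cases[OF assms(2)]
  by (elim insertE emptyE) simp_all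

subsection \<open>Hexagonal balls\<close>

text \<open>Distance from the origin in the grid, as \<open>walk_in_hexball\<close> and
  \<open>hexball_walk\<close> establish later.\<close>

definition hexnorm :: "int \<times> int \<Rightarrow> int" where
  "hexnorm p = max \<bar>fst p\<bar> (max \<bar>snd p\<bar> \<bar>fst p + snd p\<bar>)"

definition hexball :: "int \<times> int \<Rightarrow> nat \<Rightarrow> (int \<times> int) set" where
  "hexball c k = {p. hexnorm (p - c) \<le> int k}"

lemma hexball_mono: "k \<le> l \<Longrightarrow> hexball c k \<subseteq> hexball c l"
  by (auto simp: hexball_def)

lemma hexball_nb:
  assumes "p \<in> hexball c k" "q \<in> nb p"
  shows "q \<in> hexball c (Suc k)"
proof -
  have "\<forall>d\<in>dirs. hexnorm d \<le> 1"
    by (simp add: dirs_def hexnorm_def)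
  then have "hexnorm (q - p) \<le> 1"
    using assms(2) by (simp add: in_nb_iff)
  then show ?thesis
    using assms(1) by (auto simp: hexball_def hexnorm_def)
qed

definition hex_row :: "nat \<Rightarrow> int \<Rightarrow> int set" where
  "hex_row k b = {max (- int k) (- int k - b)..min (int k) (int k - b)}"

lemma finite_hex_row [simp]: "finite (hex_row k b)"
  by (simp add: hex_row_def)

text \<open>Slicing into rows reduces counting in a ball to counting in integer intervals, both for
  the size of the ball and for the density of the pattern.\<close>

lemma hexball_rows: "hexball c k = (\<lambda>(b, a). c + (a, b)) ` Sigma {- int k..int k} (hex_row k)"
proof (intro equalityI subsetI)
  fix p assume "p \<in> hexball c k"
  then have "(snd (p - c), fst (p - c)) \<in> Sigma {- int k..int k} (hex_row k)"
    by (auto simp: hexball_def hexnorm_def hex_row_def)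
  then show "p \<in> (\<lambda>(b, a). c + (a, b)) ` Sigma {- int k..int k} (hex_row k)"
    by (rule rev_image_eqI) (simp add: prod_eq_iff)
qed (auto simp: hexball_def hexnorm_def hex_row_def)

lemma finite_hexball [simp]: "finite (hexball c k)"
  unfolding hexball_rows by (auto simp: hex_row_def)

lemma card_hexball_Int:
  "card (hexball c k \<inter> X) = (\<Sum>b = - int k..int k. card {a \<in> hex_row k b. c + (a, b) \<in> X})"
proof -
  have "hexball c k \<inter> X = (\<lambda>(b, a). c + (a, b)) ` Sigma {- int k..int k} (\<lambda>b. {a \<in> hex_row k b. c + (a, b) \<in> X})"
    unfolding hexball_rows by (auto simp: image_iff Bex_def)
  also have "card \<dots> = card (Sigma {- int k..int k} (\<lambda>b. {a \<in> hex_row k b. c + (a, b) \<in> X}))"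
    by (rule card_image) (auto simp: inj_on_def)
  also have "\<dots> = (\<Sum>b = - int k..int k. card {a \<in> hex_row k b. c + (a, b) \<in> X})"
    by (rule card_SigmaI) auto
  finally show ?thesis .
qed

lemma card_hex_row: "b \<in> {- int k..int k} \<Longrightarrow> int (card (hex_row k b)) = 2 * int k + 1 - \<bar>b\<bar>"
  by (auto simp: hex_row_def)

lemma sum_abs_symmetric_interval: "(\<Sum>b = - int k..int k. \<bar>b\<bar>) = int k * (int k + 1)"
proof (induction k)
  case (Suc k)
  have "{- int (Suc k)..int (Suc k)} = insert (- int (Suc k)) (insert (int (Suc k)) {- int k..int k})"
    by auto
  then show ?case
    using Suc by (simp add: algebra_simps)
qed simp

lemma card_hexball: "card (hexball c k) = 3 * k * k + 3 * k + 1"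
proof -
  have "int (card (hexball c k)) = (\<Sum>b = - int k..int k. 2 * int k + 1 - \<bar>b\<bar>)"
    using card_hexball_Int[of c k UNIV] card_hex_row[of _ k] by simp
  also have "\<dots> = int (3 * k * k + 3 * k + 1)"
    by (simp add: sum_subtractf sum_abs_symmetric_interval algebra_simps)
  finally show ?thesis
    by linarith
qed

text \<open>Double counting of adjacent pairs. The radius grows by one because neighbors of points
  of the ball may lie outside it.\<close>

lemma sum_nb_swap:
  fixes f :: "int \<times> int \<Rightarrow> int \<times> int \<Rightarrow> nat"
  shows "(\<Sum>p\<in>hexball c k. \<Sum>q\<in>nb p. f q p) \<le> (\<Sum>q\<in>hexball c (Suc k). \<Sum>p\<in>nb q. f q p)"
proof -
  have "{q \<in> hexball c (Suc k). q \<in> nb p} = nb p" if "p \<in> hexball c k" for p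
    using hexball_nb[OF that] by blast
  then have "(\<Sum>p\<in>hexball c k. \<Sum>q\<in>nb p. f q p) =
      (\<Sum>p\<in>hexball c k. \<Sum>q\<in>{q \<in> hexball c (Suc k). q \<in> nb p}. f q p)"
    by simp
  also have "\<dots> = (\<Sum>q\<in>hexball c (Suc k). \<Sum>p\<in>{p \<in> hexball c k. q \<in> nb p}. f q p)"
    by (intro sum.swap_restrict) auto
  also have "\<dots> \<le> (\<Sum>q\<in>hexball c (Suc k). \<Sum>p\<in>nb q. f q p)"
    by (intro sum_mono sum_mono2) (use nb_sym in auto)
  finally show ?thesis .
qed

subsection \<open>Discharging\<close>

locale OLD_lattice =
  fixes S :: "(int \<times> int) set"
  assumes dominating: "nb p \<inter> S \<noteq> {}"
    and separating: "p \<noteq> q \<Longrightarrow> nb p \<inter> S \<noteq> nb q \<inter> S"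
begin

definition deg :: "int \<times> int \<Rightarrow> nat" where
  "deg p = card (nb p \<inter> S)"

definition owner :: "int \<times> int \<Rightarrow> bool" where
  "owner v \<longleftrightarrow> (\<exists>u. nb u \<inter> S = {v})"

text \<open>For \<open>v\<close> in \<open>S\<close>, the vertex \<open>h\<close> completes a
  triangle with \<open>v\<close> and another point of \<open>S\<close>; these are the vertices from
  which \<open>v\<close> may claim.\<close>

definition tri :: "int \<times> int \<Rightarrow> int \<times> int \<Rightarrow> bool" where
  "tri v h \<longleftrightarrow> h \<in> nb v \<and> 3 \<le> deg h \<and> nb v \<inter> nb h \<inter> S \<noteq> {}"

text \<open>The critical case: three consecutive points on the hexagon, with \<open>h + f\<close> in
  the middle.\<close>

definition conseq :: "int \<times> int \<Rightarrow> bool" where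
  "conseq h \<longleftrightarrow> (\<exists>e f. hexbasis e f \<and> nb h \<inter> S = {h + e, h + f, h + (f - e)})"

lemma deg_two:
  assumes "{x, y} \<subseteq> nb p \<inter> S" "x \<noteq> y" "deg p < 3"
  shows "nb p \<inter> S = {x, y}"
proof -
  have "card {x, y} = card (nb p \<inter> S)"
    using assms card_mono[OF _ assms(1)] by (simp add: deg_def)
  then show ?thesis
    using card_subset_eq[OF _ assms(1)] by simp
qed

lemma deg_three:
  assumes "{x, y} \<subseteq> nb p \<inter> S" "x \<noteq> y" "nb p \<inter> S \<noteq> {x, y}"
  shows "3 \<le> deg p"
  using deg_two[OF assms(1,2)] assms(3) by linarith

text \<open>If both degrees were below 3, both vertices would see exactly \<open>{x, y}\<close>,
  against separation.\<close>

lemma one_of_two_heavy: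
  assumes "{x, y} \<subseteq> nb p \<inter> S" "{x, y} \<subseteq> nb q \<inter> S" "x \<noteq> y" "p \<noteq> q"
  shows "3 \<le> deg p \<or> 3 \<le> deg q"
  using deg_two[OF assms(1,3)] deg_two[OF assms(2,3)] separating[OF assms(4)]
  by (metis not_le)

lemma tri_exists:
  assumes "v \<in> S"
  obtains h where "tri v h"
proof -
  obtain x where x: "x \<in> nb v" "x \<in> S"
    using dominating by blast
  obtain f where f: "hexbasis (x - v) f"
    using hexbasis_exists x(1) unfolding in_nb_iff by blast
  \<comment> \<open>The two common neighbors of \<open>v\<close> and \<open>x\<close>.\<close>
  define p q where "p = v + f" and "q = v + (x - v - f)"
  have pq: "p \<in> nb v" "q \<in> nb v" "p \<in> nb x" "q \<in> nb x"
    using f hexbasis_mirror(3)[OF f] uminus_dirs[of f] 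
    by (auto simp: p_def q_def in_nb_iff hexbasis_def algebra_simps)
  have "p \<noteq> q"
    using hexbasis_neq(5)[OF f] by (auto simp: p_def q_def algebra_simps)
  moreover have "x \<noteq> v"
    using x by (auto simp: in_nb_iff dirs_def int_pair_eq_0)
  moreover have "{v, x} \<subseteq> nb p \<inter> S" "{v, x} \<subseteq> nb q \<inter> S"
    using pq assms x nb_sym by blast+
  ultimately have "3 \<le> deg p \<or> 3 \<le> deg q"
    using one_of_two_heavy by blast
  moreover have "x \<in> nb v \<inter> nb p \<inter> S" "x \<in> nb v \<inter> nb q \<inter> S"
    using pq x nb_sym by blast+
  ultimately have "tri v p \<or> tri v q"
    using pq unfolding tri_def by blast
  then show ?thesis
    using that by blast
qed

section \<open>Local structure around three consecutive points\<close>

lemma conseq_third: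
  assumes "conseq h" "hexbasis e f" "h + e \<in> S" "h + f \<in> S"
  shows "nb h \<inter> S = {h + e, h + f, h + (f - e)} \<or> nb h \<inter> S = {h + e, h + f, h + (e - f)}"
proof -
  obtain e' f' where b: "hexbasis e' f'" and I: "nb h \<inter> S = {h + e', h + f', h + (f' - e')}"
    using assms(1) by (auto simp: conseq_def)
  have "h + e \<in> nb h \<inter> S" "h + f \<in> nb h \<inter> S"
    using assms nb_hexbasis[OF assms(2)] by auto
  then have "e \<in> {e', f', f' - e'}" "f \<in> {e', f', f' - e'}"
    unfolding I by auto
  moreover have "e \<noteq> f"
    using hexbasis_neq[OF assms(2)] by blast
  \<comment> \<open>The two ends of the path are not adjacent, so one of \<open>e\<close>,
    \<open>f\<close> is the middle direction \<open>f'\<close>.\<close>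
  moreover have "\<not> (e = e' \<and> f = f' - e')" "\<not> (e = f' - e' \<and> f = e')"
    using hexbasis_far[OF b] assms(2) hexbasis_mirror(2)[OF assms(2)] by (auto simp: hexbasis_def)
  ultimately consider "e' = e" "f' = f" | "e' = f" "f' = e" | "e' = e - f" "f' = e" | "e' = f - e" "f' = f"
    by fastforce
  then show ?thesis
    unfolding I by cases auto
qed

text \<open>If this point \<open>x\<close> were in \<open>S\<close>, then \<open>x\<close> would be
  the only vertex that can see \<open>h + e\<close> alone. One of the two common neighbors of
  \<open>h + e\<close> and \<open>x\<close> is heavy, hence \<open>conseq\<close>; its third point
  would be \<open>h\<close> or \<open>h + e + f\<close>, which are not in \<open>S\<close>, or a
  second neighbor of \<open>x\<close> in \<open>S\<close>.\<close>

lemma path_end_degree_one: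
  assumes b: "hexbasis e f"
    and I: "nb h \<inter> S = {h + e, h + f, h + (f - e)}"
    and own: "owner (h + e)"
    and free: "\<And>g. tri (h + e) g \<Longrightarrow> conseq g"
    and notS: "h \<notin> S" "h + e + f \<notin> S"
    and IA: "nb (h + e + f) \<inter> S = {h + e, h + f}"
  shows "h + e + (e - f) \<notin> S"
proof
  define x where "x = h + e + (e - f)"
  assume "h + e + (e - f) \<in> S"
  then have xS: "x \<in> S"
    by (simp add: x_def)
  note nb = nb_hexbasis[OF b]
  note neq = hexbasis_neq[OF b]
  have S: "h + e \<in> S" "h + f \<in> S" "h + (f - e) \<in> S"
    using I by auto
  obtain u where u: "nb u \<inter> S = {h + e}"
    using own by (auto simp: owner_def)
  then have "u \<in> nb (h + e)"
    using nb_sym by blast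
  then have "u \<in> {h + e + e, h + e + f, h + f, h, h + (e - f), x}"
    unfolding nb by (auto simp: x_def algebra_simps)
  moreover have "u \<noteq> h + e + e"
  proof
    assume "u = h + e + e"
    then have "x \<in> nb u \<inter> S" using xS by (auto simp: nb x_def algebra_simps)
    then show False using u neq by (simp add: x_def)
  qed
  moreover have "u \<noteq> h + e + f"
    using u IA neq by auto
  moreover have "u \<noteq> h + f"
  proof
    assume "u = h + f"
    then have "h + (f - e) \<in> nb u \<inter> S" using S by (auto simp: nb algebra_simps)
    then show False using u neq by (simp add: algebra_simps)
  qed
  moreover have "u \<noteq> h"
    using u I neq by auto
  moreover have "u \<noteq> h + (e - f)"
  proof
    assume "u = h + (e - f)"
    then have "x \<in> nb u \<inter> S" using xS by (auto simp: nb x_def algebra_simps)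
    then show False using u neq by (simp add: x_def)
  qed
  ultimately have Ix: "nb x \<inter> S = {h + e}"
    using u by blast
  define p q where "p = h + (e - f)" and "q = h + e + e"
  have "{h + e, x} \<subseteq> nb p \<inter> S" "{h + e, x} \<subseteq> nb q \<inter> S"
    using S xS by (auto simp: nb x_def p_def q_def algebra_simps)
  moreover have "h + e \<noteq> x" "p \<noteq> q"
    using neq by (auto simp: x_def p_def q_def algebra_simps)
  ultimately have "3 \<le> deg p \<or> 3 \<le> deg q"
    by (rule one_of_two_heavy)
  then show False
  proof
    assume "3 \<le> deg p"
    then have "tri (h + e) p"
      unfolding tri_def using xS by (auto simp: nb x_def p_def algebra_simps)
    then have "conseq p" by (rule free)
    moreover have "p + e \<in> S" "p + f \<in> S"
      using S xS by (simp_all add: p_def x_def algebra_simps)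
    ultimately have "p + (f - e) \<in> S \<or> p + (e - f) \<in> S"
      using conseq_third[OF _ b] by blast
    moreover have "p + (f - e) \<notin> S"
      using notS by (simp add: p_def)
    moreover have "p + (e - f) \<notin> S"
    proof
      assume "p + (e - f) \<in> S"
      then have "p + (e - f) \<in> nb x \<inter> S"
        by (auto simp: nb x_def p_def algebra_simps)
      then show False using Ix neq by (auto simp: p_def algebra_simps)
    qed
    ultimately show False by blast
  next
    assume "3 \<le> deg q"
    then have "tri (h + e) q"
      unfolding tri_def using xS by (auto simp: nb x_def q_def algebra_simps)
    then have "conseq q" by (rule free)
    moreover have "q + (- e) \<in> S" "q + (- f) \<in> S"
      using S xS by (simp_all add: q_def x_def algebra_simps)
    ultimately have "q + (- f - (- e)) \<in> S \<or> q + (- e - (- f)) \<in> S"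
      using conseq_third[OF _ hexbasis_mirror(4)[OF b]] by blast
    moreover have "q + (- e - (- f)) \<notin> S"
      using notS by (simp add: q_def algebra_simps)
    moreover have "q + (- f - (- e)) \<notin> S"
    proof
      assume "q + (- f - (- e)) \<in> S"
      then have "q + (- f - (- e)) \<in> nb x \<inter> S"
        by (auto simp: nb x_def q_def algebra_simps)
      then show False using Ix neq by (auto simp: q_def algebra_simps)
    qed
    ultimately show False by blast
  qed
qed

text \<open>Of the other neighbors of \<open>h + e\<close>, the points \<open>h + e + e\<close> and
  \<open>h + (e - f)\<close> would be seen from the light vertex \<open>h + e + f\<close> and from
  \<open>h\<close>. The remaining two are excluded by the shape of \<open>conseq\<close> vertices,
  with \<open>path_end_degree_one\<close> if \<open>h\<close> is not in \<open>S\<close>.\<close>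

lemma path_nb_end:
  assumes b: "hexbasis e f"
    and I: "nb h \<inter> S = {h + e, h + f, h + (f - e)}"
    and own: "owner (h + e)"
    and free: "\<And>v g. v \<in> {h + e, h + f, h + (f - e)} \<Longrightarrow> tri v g \<Longrightarrow> conseq g"
    and light: "deg (h + e + f) < 3"
  shows "nb (h + e) \<inter> S = (if h \<in> S then {h, h + f} else {h + f})"
proof -
  note nb = nb_hexbasis[OF b]
  note neq = hexbasis_neq[OF b]
  have S: "h + e \<in> S" "h + f \<in> S" "h + (f - e) \<in> S"
    using I by auto
  have IA: "nb (h + e + f) \<inter> S = {h + e, h + f}"
    using S light neq by (intro deg_two) (auto simp: nb algebra_simps)
  have A: "h + e + f \<notin> S"
  proof
    assume A: "h + e + f \<in> S"
    \<comment> \<open>Then \<open>h + f\<close> would have to be \<open>conseq\<close>, although it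
      sees the opposite points \<open>h + e + f\<close> and \<open>h + (f - e)\<close>.\<close>
    have "3 \<le> deg (h + f)"
    proof (rule deg_three)
      show "{h + e, h + e + f} \<subseteq> nb (h + f) \<inter> S"
        using S A by (auto simp: nb algebra_simps)
      have "h + (f - e) \<in> nb (h + f) \<inter> S"
        using S by (auto simp: nb algebra_simps)
      moreover have "h + (f - e) \<notin> {h + e, h + e + f}"
        using neq by (auto simp: algebra_simps)
      ultimately show "nb (h + f) \<inter> S \<noteq> {h + e, h + e + f}"
        by blast
    qed (use neq in simp)
    then have "tri (h + e) (h + f)"
      unfolding tri_def using A by (auto simp: nb algebra_simps)
    then have "conseq (h + f)"
      using free by blast
    moreover have "h + f + e \<in> S" "h + f + (e - f) \<in> S"
      using S A by (simp_all add: algebra_simps)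
    ultimately have "nb (h + f) \<inter> S \<subseteq> {h + f + e, h + f + (e - f), h + f + (e - f - e), h + f + (e - (e - f))}"
      using conseq_third[OF _ hexbasis_mirror(3)[OF b]] by blast
    moreover have "h + (f - e) \<in> nb (h + f) \<inter> S"
      using S by (auto simp: nb algebra_simps)
    ultimately have "h + (f - e) \<in> {h + f + e, h + f + (e - f), h + f + (e - f - e), h + f + (e - (e - f))}"
      by blast
    then show False
      using neq by (auto simp: algebra_simps)
  qed
  have e2: "h + e + e \<notin> S"
  proof
    assume "h + e + e \<in> S"
    then have "h + e + e \<in> nb (h + e + f) \<inter> S"
      by (auto simp: nb algebra_simps)
    then show False
      using IA neq by auto
  qed
  have e5: "h + (e - f) \<notin> S"
  proof
    assume "h + (e - f) \<in> S"
    then have "h + (e - f) \<in> nb h \<inter> S"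
      by (auto simp: nb)
    then show False
      unfolding I using neq by (auto simp: algebra_simps)
  qed
  show ?thesis
  proof (cases "h \<in> S")
    case True
    have *: "{h, h + f} \<subseteq> nb (h + e) \<inter> S" "h \<noteq> h + f"
      using S True neq by (auto simp: nb)
    \<comment> \<open>Otherwise \<open>h + f\<close> could claim from \<open>h + e\<close>, by the
      triangle with \<open>h\<close>; being \<open>conseq\<close>, \<open>h + e\<close> would see
      \<open>h + e + f\<close> or \<open>h + (e - f)\<close>.\<close>
    have "deg (h + e) < 3"
    proof (rule ccontr)
      assume "\<not> deg (h + e) < 3"
      then have "tri (h + f) (h + e)"
        unfolding tri_def using True by (auto simp: nb)
      then have "conseq (h + e)"
        using free by blast
      moreover have "h + e + (f - e) \<in> S" "h + e + (- e) \<in> S"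
        using S True by simp_all
      ultimately have "h + e + (- e - (f - e)) \<in> S \<or> h + e + (f - e - - e) \<in> S"
        using conseq_third[OF _ hexbasis_mirror(5)[OF b]] by blast
      then show False
        using A e5 by (simp add: algebra_simps)
    qed
    then show ?thesis
      using deg_two[OF *] True by simp
  next
    case False
    have "h + e + (e - f) \<notin> S"
      by (rule path_end_degree_one[OF b I own _ False A IA]) (use free in blast)
    then show ?thesis
      using False A e2 e5 S by (auto simp: nb algebra_simps)
  qed
qed

text \<open>If both outer vertices were light, \<open>path_nb_end\<close> and its mirror image would
  give the two ends \<open>h + e\<close> and \<open>h + (f - e)\<close> the same neighbors in
  \<open>S\<close>.\<close>

lemma path_neighbour_heavy:
  assumes b: "hexbasis e f"
    and I: "nb h \<inter> S = {h + e, h + f, h + (f - e)}"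
    and own: "owner (h + e)" "owner (h + (f - e))"
    and free: "\<And>v g. v \<in> {h + e, h + f, h + (f - e)} \<Longrightarrow> tri v g \<Longrightarrow> conseq g"
  shows "3 \<le> deg (h + e + f) \<or> 3 \<le> deg (h + (f - e) + f)"
proof (rule ccontr)
  assume "\<not> ?thesis"
  have I': "nb h \<inter> S = {h + (f - e), h + f, h + (f - (f - e))}"
    unfolding I by auto
  from \<open>\<not> ?thesis\<close> have "nb (h + e) \<inter> S = (if h \<in> S then {h, h + f} else {h + f})"
    and "nb (h + (f - e)) \<inter> S = (if h \<in> S then {h, h + f} else {h + f})"
    using path_nb_end[OF b I own(1) free] path_nb_end[OF hexbasis_mirror(1)[OF b] I' own(2)] free
    by (simp_all add: insert_commute)
  moreover have "h + e \<noteq> h + (f - e)"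
    using hexbasis_neq[OF b] by (auto simp: algebra_simps)
  ultimately show False
    using separating by metis
qed

section \<open>The payments and their balance\<close>

definition free :: "int \<times> int \<Rightarrow> bool" where
  "free v \<longleftrightarrow> (\<forall>g. tri v g \<longrightarrow> conseq g)"

text \<open>
  In units of half an owner. An overpayment is harmless: only \<open>heavy_pays\<close> has to bound it.
\<close>

definition pay :: "int \<times> int \<Rightarrow> int \<times> int \<Rightarrow> nat" where
  "pay h v =
    (if \<not> (owner v \<and> tri v h) then 0
     else if \<not> conseq h then 2
     else if \<not> free v then 0
     else if \<exists>g. g \<noteq> h \<and> tri v g then 1 else 2)"

lemma owner_in_S: "owner v \<Longrightarrow> v \<in> S"
  unfolding owner_def by blast

lemma pay_le_2: "pay h v \<le> 2"
  by (simp add: pay_def)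

text \<open>A vertex that is not \<open>conseq\<close> pays 2 on its own. Without such a vertex,
  \<open>v\<close> is \<open>free\<close> and receives 1 from each of at least two vertices, or 2
  from a single one.\<close>

lemma owner_paid:
  assumes "owner v"
  shows "2 \<le> (\<Sum>h\<in>nb v. pay h v)"
proof -
  have le: "sum (\<lambda>h. pay h v) H \<le> (\<Sum>h\<in>nb v. pay h v)" if "H \<subseteq> nb v" for H
    using that by (intro sum_mono2) auto
  have tri_nb: "h \<in> nb v" if "tri v h" for h
    using that by (simp add: tri_def)
  obtain h where h: "tri v h"
    using tri_exists owner_in_S assms by blast
  consider g where "tri v g" "\<not> conseq g"
    | g where "free v" "tri v g" "g \<noteq> h"
    | "free v" "\<And>g. tri v g \<Longrightarrow> g = h"
    unfolding free_def by blast
  then show ?thesis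
  proof cases
    case 1
    then show ?thesis
      using le[of "{g}"] tri_nb assms by (simp add: pay_def)
  next
    case 2
    then have "pay h v = 1" "pay g v = 1"
      using h assms unfolding pay_def free_def by metis+
    then show ?thesis
      using le[of "{g, h}"] tri_nb 2 h by simp
  next
    case 3
    then have "pay h v = 2"
      using h assms unfolding pay_def free_def by metis
    then show ?thesis
      using le[of "{h}"] tri_nb h by simp
  qed
qed

text \<open>Each of the three points is adjacent to another of them, so one is adjacent to both
  others; on a hexagon they are then consecutive.\<close>

lemma conseq_if_all_tri:
  assumes "deg h = 3" "\<And>v. v \<in> nb h \<inter> S \<Longrightarrow> tri v h"
  shows "conseq h"
proof -
  obtain v where v: "v \<in> nb h \<inter> S"
    using dominating by blast
  then obtain y where y: "y \<in> nb v" "y \<in> nb h \<inter> S"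
    using assms(2) unfolding tri_def by blast
  define e f where "e = y - h" and "f = v - h"
  have ef: "h + e = y" "h + f = v"
    by (simp_all add: e_def f_def)
  have "e \<in> dirs" "f \<in> dirs"
    using v y by (simp_all add: e_def f_def in_nb_iff)
  moreover have "v \<in> nb y"
    using y nb_sym by blast
  ultimately have b: "hexbasis e f"
    by (simp add: hexbasis_def e_def f_def in_nb_iff)
  note b' = hexbasis_mirror(2)[OF b]
  have "y \<noteq> v"
    using hexbasis_neq(3)[OF b] by (auto simp: e_def f_def)
  have "card (nb h \<inter> S - {y, v}) = 1"
    using assms(1) v y \<open>y \<noteq> v\<close> by (subst card_Diff_subset) (auto simp: deg_def)
  then obtain z where z: "nb h \<inter> S - {y, v} = {z}"
    by (rule card_1_singletonE)
  then have I: "nb h \<inter> S = {y, v, z}"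
    using v y by blast
  have z': "z \<in> nb h" "z \<noteq> y" "z \<noteq> v"
    using z by blast+
  define g where "g = z - h"
  have "tri z h"
    using assms(2) z by blast
  then obtain x where "x \<in> nb z" "x \<in> nb h \<inter> S"
    unfolding tri_def by blast
  moreover have "z \<notin> nb z"
    by (simp add: in_nb_iff dirs_def int_pair_eq_0)
  ultimately have "y \<in> nb z \<or> v \<in> nb z"
    unfolding I by auto
  then have "z \<in> nb y \<or> z \<in> nb v"
    using nb_sym by blast
  moreover have "g \<in> dirs"
    using z'(1) by (simp add: g_def in_nb_iff)
  ultimately have "hexbasis e g \<or> hexbasis f g"
    using b by (auto simp: hexbasis_def e_def f_def g_def in_nb_iff)
  moreover have "g \<noteq> e" "g \<noteq> f"
    using z' by (simp_all add: g_def e_def f_def)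
  ultimately have "g = e - f \<or> g = f - e"
    using hexbasis_unique[OF b] hexbasis_unique[OF b'] by blast
  moreover have "h + g = z"
    by (simp add: g_def)
  ultimately have "nb h \<inter> S = {h + f, h + e, h + (e - f)} \<or> nb h \<inter> S = {h + e, h + f, h + (f - e)}"
    unfolding I using ef by auto
  then show ?thesis
    unfolding conseq_def using b b' by blast
qed

text \<open>Three claims of 2 would exceed the budget. If all three points claim, they are free
  owners, and \<open>path_neighbour_heavy\<close> yields a second heavy vertex that two of them
  share; those two claim only 1 each.\<close>

lemma conseq_pays:
  assumes "conseq h"
  shows "(\<Sum>v\<in>nb h \<inter> S. pay h v) \<le> 4"
proof -
  obtain e f where b: "hexbasis e f" and I: "nb h \<inter> S = {h + e, h + f, h + (f - e)}"
    using assms by (auto simp: conseq_def)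
  note nb = nb_hexbasis[OF b]
  note neq = hexbasis_neq[OF b]
  have S: "h + e \<in> S" "h + f \<in> S" "h + (f - e) \<in> S"
    using I by auto
  have sum: "(\<Sum>v\<in>nb h \<inter> S. pay h v) = pay h (h + e) + pay h (h + f) + pay h (h + (f - e))"
    unfolding I using neq by (subst sum.insert | simp add: algebra_simps)+
  show ?thesis
  proof (cases "\<forall>v\<in>{h + e, h + f, h + (f - e)}. pay h v \<noteq> 0")
    case True
    then have own: "owner v" "free v" if "v \<in> {h + e, h + f, h + (f - e)}" for v
      using that assms unfolding pay_def by metis+
    have one: "pay h v \<le> 1" if "tri v g" "g \<noteq> h" for v g
      using that assms by (auto simp: pay_def simp del: split_paired_All split_paired_Ex)
    have "3 \<le> deg (h + e + f) \<or> 3 \<le> deg (h + (f - e) + f)"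
      by (rule path_neighbour_heavy[OF b I]) (use own in \<open>auto simp: free_def simp del: split_paired_All\<close>)
    then show ?thesis
    proof
      assume "3 \<le> deg (h + e + f)"
      then have "tri (h + e) (h + e + f)" "tri (h + f) (h + e + f)"
        unfolding tri_def using S by (auto simp: nb algebra_simps)
      moreover have "h + e + f \<noteq> h"
        using neq by (simp add: add.assoc)
      ultimately show ?thesis
        using one[of "h + e"] one[of "h + f"] pay_le_2[of h "h + (f - e)"] by (fastforce simp: sum)
    next
      assume "3 \<le> deg (h + (f - e) + f)"
      then have "tri (h + (f - e)) (h + (f - e) + f)" "tri (h + f) (h + (f - e) + f)"
        unfolding tri_def using S by (auto simp: nb algebra_simps)
      moreover have "h + (f - e) + f \<noteq> h"
        using neq by (simp add: algebra_simps)
      ultimately show ?thesis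
        using one[of "h + (f - e)"] one[of "h + f"] pay_le_2[of h "h + e"] by (fastforce simp: sum)
    qed
  next
    case False
    then show ?thesis
      unfolding sum
      using pay_le_2[of h "h + e"] pay_le_2[of h "h + f"] pay_le_2[of h "h + (f - e)"] by auto
  qed
qed

text \<open>The budget \<open>2 * (deg h - 2)\<close>, counted in half owners. Truncated subtraction
  makes it 0 for light vertices, which pay nothing; from degree 4 on, it covers a claim of 2 by
  every neighbor in \<open>S\<close>.\<close>

lemma heavy_pays: "(\<Sum>v\<in>nb h. pay h v) \<le> 4 * (deg h - 2)"
proof -
  have le: "(\<Sum>v\<in>A. pay h v) \<le> 2 * card A" for A
    using sum_bounded_above[of A "pay h" 2] pay_le_2 by (simp add: mult.commute)
  have sum: "(\<Sum>v\<in>nb h. pay h v) = (\<Sum>v\<in>nb h \<inter> S. pay h v)"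
    using owner_in_S by (intro sum.mono_neutral_right) (auto simp: pay_def)
  consider "deg h < 3" | "deg h = 3" | "deg h \<ge> 4"
    by linarith
  then show ?thesis
  proof cases
    case 1
    then show ?thesis
      by (simp add: pay_def tri_def)
  next
    case 2
    show ?thesis
    proof (cases "conseq h")
      case True
      then show ?thesis
        using conseq_pays sum 2 by simp
    next
      case False
      then obtain v where v: "v \<in> nb h \<inter> S" "\<not> tri v h"
        using conseq_if_all_tri[OF 2] by blast
      then have "(\<Sum>v\<in>nb h \<inter> S. pay h v) = (\<Sum>v\<in>nb h \<inter> S - {v}. pay h v)"
        by (intro sum.mono_neutral_right) (auto simp: pay_def)
      also have "\<dots> \<le> 4"
        using le[of "nb h \<inter> S - {v}"] v 2 by (simp add: deg_def)
      finally show ?thesis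
        using sum 2 by simp
    qed
  next
    case 3
    then show ?thesis
      using le[of "nb h \<inter> S"] sum by (simp add: deg_def)
  qed
qed

subsection \<open>Counting\<close>

lemma sum_deg_hexball: "(\<Sum>h\<in>hexball c k. deg h) \<le> 6 * card (hexball c (Suc k) \<inter> S)"
proof -
  have "(\<Sum>h\<in>hexball c k. deg h) = (\<Sum>h\<in>hexball c k. \<Sum>q\<in>nb h. of_bool (q \<in> S))"
    by (simp add: deg_def Int_def)
  also have "\<dots> \<le> (\<Sum>q\<in>hexball c (Suc k). \<Sum>h\<in>nb q. of_bool (q \<in> S))"
    by (rule sum_nb_swap)
  also have "\<dots> = (\<Sum>q\<in>hexball c (Suc k). 6 * of_bool (q \<in> S))"
    by (simp add: card_nb)
  also have "\<dots> = 6 * card (hexball c (Suc k) \<inter> S)"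
    by (simp add: sum_distrib_left[symmetric] Int_def)
  finally show ?thesis .
qed

text \<open>By separation, a vertex of degree one is determined by its only neighbor in
  \<open>S\<close>.\<close>

lemma card_deg_one:
  "card {u \<in> hexball c k. deg u = 1} \<le> card {v \<in> hexball c (Suc k). owner v}"
proof -
  define g where "g u = (THE v. nb u \<inter> S = {v})" for u
  have g: "nb u \<inter> S = {g u}" if u: "deg u = 1" for u
  proof -
    obtain v where "nb u \<inter> S = {v}"
      using u unfolding deg_def by (rule card_1_singletonE)
    then show ?thesis
      by (simp add: g_def)
  qed
  show ?thesis
  proof (rule card_inj_on_le)
    show "inj_on g {u \<in> hexball c k. deg u = 1}"
      using g separating by (intro inj_onI) (metis (mono_tags, lifting) mem_Collect_eq)
    show "g ` {u \<in> hexball c k. deg u = 1} \<subseteq> {v \<in> hexball c (Suc k). owner v}"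
    proof (intro image_subsetI CollectI conjI)
      fix u assume u: "u \<in> {u \<in> hexball c k. deg u = 1}"
      then have gu: "nb u \<inter> S = {g u}"
        using g by blast
      then show "owner (g u)"
        unfolding owner_def by blast
      have "g u \<in> nb u"
        using gu by blast
      then show "g u \<in> hexball c (Suc k)"
        using u hexball_nb by blast
    qed
  qed simp
qed

lemma two_owners_le:
  "2 * card {v \<in> hexball c k. owner v} \<le> 4 * (\<Sum>h\<in>hexball c (Suc k). deg h - 2)"
proof -
  have "2 * card {v \<in> hexball c k. owner v} = (\<Sum>v\<in>{v \<in> hexball c k. owner v}. 2)"
    by simp
  also have "\<dots> \<le> (\<Sum>v\<in>{v \<in> hexball c k. owner v}. \<Sum>h\<in>nb v. pay h v)"
    using owner_paid by (intro sum_mono) simp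
  also have "\<dots> \<le> (\<Sum>v\<in>hexball c k. \<Sum>h\<in>nb v. pay h v)"
    by (intro sum_mono2) auto
  also have "\<dots> \<le> (\<Sum>h\<in>hexball c (Suc k). \<Sum>v\<in>nb h. pay h v)"
    by (rule sum_nb_swap)
  also have "\<dots> \<le> (\<Sum>h\<in>hexball c (Suc k). 4 * (deg h - 2))"
    using heavy_pays by (intro sum_mono) simp
  finally show ?thesis
    by (simp add: sum_distrib_left)
qed

text \<open>The density inequality \<open>4 \<le> 13 * \<rho>\<close> with its boundary terms: twice
  the degree count, with \<open>own k\<close> bounded by twice the excess and one of the two terms
  \<open>own (k + 2)\<close> by the size of \<open>S\<close> in the ball.\<close>

lemma hexball_count:
  "4 * card (hexball c (Suc k)) + card (hexball c k)
     \<le> 13 * card (hexball c (Suc (Suc k)) \<inter> S) + card (hexball c (Suc (Suc k)))"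
proof -
  define own where "own j = card {v \<in> hexball c j. owner v}" for j
  \<comment> \<open>Truncated subtraction loses 1 at degree 1, and degree 0 is excluded by
    domination.\<close>
  have "deg h - 2 + 2 = deg h + of_bool (deg h = 1)" for h
  proof -
    have "deg h \<noteq> 0"
      using dominating by (simp add: deg_def)
    then show ?thesis by auto
  qed
  then have "(\<Sum>h\<in>hexball c (Suc k). deg h - 2 + 2) = (\<Sum>h\<in>hexball c (Suc k). deg h + of_bool (deg h = 1))"
    by (intro sum.cong) simp_all
  then have "(\<Sum>h\<in>hexball c (Suc k). deg h - 2) + 2 * card (hexball c (Suc k))
      = (\<Sum>h\<in>hexball c (Suc k). deg h) + card {u \<in> hexball c (Suc k). deg u = 1}"
    unfolding sum.distrib by (simp add: Int_def)
  moreover have "2 * own k \<le> 4 * (\<Sum>h\<in>hexball c (Suc k). deg h - 2)"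
    unfolding own_def by (rule two_owners_le)
  moreover have "(\<Sum>h\<in>hexball c (Suc k). deg h) \<le> 6 * card (hexball c (Suc (Suc k)) \<inter> S)"
    by (rule sum_deg_hexball)
  moreover have "card {u \<in> hexball c (Suc k). deg u = 1} \<le> own (Suc (Suc k))"
    unfolding own_def by (rule card_deg_one)
  moreover have "own (Suc (Suc k)) \<le> card (hexball c (Suc (Suc k)) \<inter> S)"
    unfolding own_def using owner_in_S by (intro card_mono) auto
  \<comment> \<open>Owners are counted at two radii; the difference is at most the size of the
    annulus.\<close>
  moreover have "own (Suc (Suc k)) + card (hexball c k) \<le> own k + card (hexball c (Suc (Suc k)))"
  proof -
    have sub: "hexball c k \<subseteq> hexball c (Suc (Suc k))"
      by (rule hexball_mono) simp
    have "own (Suc (Suc k)) \<le> card ({v \<in> hexball c k. owner v} \<union> (hexball c (Suc (Suc k)) - hexball c k))"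
      unfolding own_def by (intro card_mono) auto
    also have "\<dots> \<le> own k + card (hexball c (Suc (Suc k)) - hexball c k)"
      unfolding own_def by (rule card_Un_le)
    finally show ?thesis
      using sub card_mono[OF _ sub] by (simp add: card_Diff_subset)
  qed
  ultimately show ?thesis
    by linarith
qed

end

subsection \<open>An optimal periodic set\<close>

definition pattern :: "(int \<times> int) set" where
  "pattern = {p. (fst p + 3 * snd p) mod 13 \<in> {0, 2, 5, 7}}"

text \<open>Only the residue of \<open>p\<close> matters, and the six directions change it by 1, 2
  or 3 up or down, so the pattern is checked on finitely many cases.\<close>

lemma pattern_shift:
  "p + d \<in> pattern \<longleftrightarrow> ((fst p + 3 * snd p) mod 13 + (fst d + 3 * snd d)) mod 13 \<in> {0, 2, 5, 7}"
proof -
  have "fst (p + d) + 3 * snd (p + d) = fst p + 3 * snd p + (fst d + 3 * snd d)"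
    by simp
  then show ?thesis
    unfolding pattern_def mem_Collect_eq mod_add_left_eq by metis
qed

lemma pattern_dominating:
  "\<forall>t\<in>{0,1,2,3,4,5,6,7,8,9,10,11,12}. \<exists>d\<in>dirs. (t + (fst d + 3 * snd d)) mod 13 \<in> {0, 2, 5, 7 :: int}"
  by (simp add: dirs_def)

text \<open>
  Offsets from a point \<open>r\<close> of the pattern, with residue \<open>s\<close>, to four further points of the pattern
  that tell the neighbors of \<open>r\<close> apart.
\<close>

definition probes :: "int \<Rightarrow> (int \<times> int) set" where
  "probes s =
    (if s = 0 then {(-1, 1), (-1, 2), (0, -2), (2, 0)}
     else if s = 2 then {(-2, 0), (-1, 2), (0, 1), (1, -1)}
     else if s = 5 then {(-1, 1), (0, -1), (1, -2), (2, 0)}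
     else {(-2, 0), (0, 2), (1, -2), (1, -1)})"

lemma probes_in_pattern:
  "\<forall>s\<in>{0, 2, 5, 7}. \<forall>y\<in>probes s. (s + (fst y + 3 * snd y)) mod 13 \<in> {0, 2, 5, 7}"
  by (simp add: probes_def)

lemma probes_separate:
  "\<forall>s\<in>{0, 2, 5, 7}. \<forall>d\<in>dirs. \<forall>d'\<in>dirs. (\<forall>y\<in>probes s. y + d \<in> dirs \<longleftrightarrow> y + d' \<in> dirs) \<longrightarrow> d = d'"
  by (simp add: probes_def dirs_def int_pair_eq_0)

lemma OLD_lattice_pattern: "OLD_lattice pattern"
proof
  fix p :: "int \<times> int"
  define t where "t = (fst p + 3 * snd p) mod 13"
  have "0 \<le> t" "t < 13"
    by (simp_all add: t_def)
  then have t: "t \<in> {0,1,2,3,4,5,6,7,8,9,10,11,12}"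
    unfolding insert_iff empty_iff by presburger
  obtain d where "d \<in> dirs" "(t + (fst d + 3 * snd d)) mod 13 \<in> {0, 2, 5, 7}"
    using bspec[OF pattern_dominating t] by (rule bexE)
  then have "p + d \<in> nb p \<inter> pattern"
    using pattern_shift[of p d] by (simp add: in_nb_iff t_def)
  then show dom: "nb p \<inter> pattern \<noteq> {}"
    by blast
  fix q :: "int \<times> int"
  assume "p \<noteq> q"
  show "nb p \<inter> pattern \<noteq> nb q \<inter> pattern"
  proof
    assume eq: "nb p \<inter> pattern = nb q \<inter> pattern"
    \<comment> \<open>Equal nonempty traces force a common neighbor in the pattern, so only pairs of
      neighbors of one point \<open>r\<close> need to be told apart.\<close>
    obtain r where r: "r \<in> nb p" "r \<in> nb q" "r \<in> pattern"
      using dom eq by blast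
    define s where "s = (fst r + 3 * snd r) mod 13"
    have s: "s \<in> {0, 2, 5, 7}"
      using r(3) by (simp add: s_def pattern_def)
    have "y + (r - p) \<in> dirs \<longleftrightarrow> y + (r - q) \<in> dirs" if "y \<in> probes s" for y
    proof -
      have "r + y \<in> pattern"
        using bspec[OF bspec[OF probes_in_pattern s] that] unfolding pattern_shift s_def .
      then have "r + y \<in> nb p \<longleftrightarrow> r + y \<in> nb q"
        using eq by blast
      then show ?thesis
        by (simp add: in_nb_iff algebra_simps)
    qed
    moreover have "r - p \<in> dirs" "r - q \<in> dirs"
      using r(1,2) by (simp_all add: in_nb_iff)
    ultimately have "r - p = r - q"
      using bspec[OF bspec[OF bspec[OF probes_separate s]]] by blast
    then show False
      using \<open>p \<noteq> q\<close> by simp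
  qed
qed

text \<open>The quotients by 13 are distinct and fill at most an interval. The 25 is 13 for its
  extra endpoint plus 12 for rounding.\<close>

lemma card_residue_interval:
  fixes l u s r :: int
  assumes "l \<le> u"
  shows "13 * int (card {a \<in> {l..u}. (a + s) mod 13 = r}) \<le> u - l + 25"
proof -
  have "card {a \<in> {l..u}. (a + s) mod 13 = r} \<le> card {(l + s) div 13..(u + s) div 13}"
  proof (rule card_inj_on_le)
    show "inj_on (\<lambda>a. (a + s) div 13) {a \<in> {l..u}. (a + s) mod 13 = r}"
    proof (rule inj_onI)
      fix a b
      assume "a \<in> {a \<in> {l..u}. (a + s) mod 13 = r}" "b \<in> {a \<in> {l..u}. (a + s) mod 13 = r}"
        and "(a + s) div 13 = (b + s) div 13"
      then show "a = b"
        using div_mult_mod_eq[of "a + s" 13] div_mult_mod_eq[of "b + s" 13] by simp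
    qed
    show "(\<lambda>a. (a + s) div 13) ` {a \<in> {l..u}. (a + s) mod 13 = r} \<subseteq> {(l + s) div 13..(u + s) div 13}"
      by (auto intro: zdiv_mono1)
  qed simp
  moreover have "(l + s) div 13 \<le> (u + s) div 13"
    using assms by (intro zdiv_mono1) auto
  ultimately have "int (card {a \<in> {l..u}. (a + s) mod 13 = r}) \<le> (u + s) div 13 - (l + s) div 13 + 1"
    by simp
  then show ?thesis
    by linarith
qed

text \<open>Four residue classes, each with an error of 24 against the length
  \<open>u - l + 1\<close> of the row. The form \<open>0 + (a, b)\<close> matches
  \<open>card_hexball_Int\<close> at center 0.\<close>

lemma card_pattern_hex_row:
  assumes "b \<in> {- int k..int k}"
  shows "13 * card {a \<in> hex_row k b. 0 + (a, b) \<in> pattern} \<le> 4 * card (hex_row k b) + 96"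
proof -
  define l u where "l = max (- int k) (- int k - b)" and "u = min (int k) (int k - b)"
  have lu: "l \<le> u"
    using assms by (auto simp: l_def u_def)
  have hex_row: "hex_row k b = {l..u}"
    by (simp add: hex_row_def l_def u_def)
  have "{a \<in> hex_row k b. 0 + (a, b) \<in> pattern} = (\<Union>r\<in>{0, 2, 5, 7}. {a \<in> {l..u}. (a + 3 * b) mod 13 = r})"
    unfolding hex_row by (auto simp: pattern_def)
  then have "card {a \<in> hex_row k b. 0 + (a, b) \<in> pattern} \<le> (\<Sum>r\<in>{0, 2, 5, 7}. card {a \<in> {l..u}. (a + 3 * b) mod 13 = r})"
    using card_UN_le[of "{0, 2, 5, 7 :: int}" "\<lambda>r. {a \<in> {l..u}. (a + 3 * b) mod 13 = r}"] by simp
  then have "13 * int (card {a \<in> hex_row k b. 0 + (a, b) \<in> pattern})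
      \<le> (\<Sum>r\<in>{0, 2, 5, 7}. 13 * int (card {a \<in> {l..u}. (a + 3 * b) mod 13 = r}))"
    unfolding sum_distrib_left[symmetric] of_nat_sum[symmetric] by linarith
  also have "\<dots> \<le> (\<Sum>r\<in>{0, 2, 5, 7 :: int}. u - l + 25)"
    using card_residue_interval[OF lu] by (intro sum_mono) blast
  also have "\<dots> = 4 * int (card (hex_row k b)) + 96"
    using lu by (simp add: hex_row)
  finally show ?thesis
    by linarith
qed

lemma card_pattern_hexball:
  "13 * card (hexball 0 k \<inter> pattern) \<le> 4 * card (hexball 0 k) + 96 * (2 * k + 1)"
proof -
  have "13 * card (hexball 0 k \<inter> pattern) \<le> (\<Sum>b = - int k..int k. 4 * card (hex_row k b) + 96)"
    unfolding card_hexball_Int sum_distrib_left by (intro sum_mono card_pattern_hex_row)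
  also have "\<dots> = 4 * card (hexball 0 k) + 96 * (2 * k + 1)"
    using card_hexball_Int[of 0 k UNIV] by (simp add: sum.distrib sum_distrib_left)
  finally show ?thesis .
qed

subsection \<open>The triangular grid in the plane\<close>

definition pt :: "int \<times> int \<Rightarrow> real \<times> real" where
  "pt p = of_int (fst p) *\<^sub>R (1, 0) + of_int (snd p) *\<^sub>R (1 / 2, sqrt 3 / 2)"

lemma tri_verts_eq: "tri_verts = range pt"
  by (auto simp: tri_verts_def pt_def image_iff)

lemma inj_pt: "inj pt"
  by (rule injI) (auto simp: pt_def prod_eq_iff)

lemma eisenstein_norm_one: "x * x + x * y + y * y = 1 \<longleftrightarrow> (x, y) \<in> dirs" for x y :: int
proof
  assume xy: "x * x + x * y + y * y = 1"
  \<comment> \<open>Completing the square in four times the norm form, once for each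
    variable.\<close>
  have "(2 * x + y)\<^sup>2 + 3 * y\<^sup>2 = 4" "(2 * y + x)\<^sup>2 + 3 * x\<^sup>2 = 4"
    using xy by (simp_all add: power2_eq_square algebra_simps)
  then have "3 * y\<^sup>2 \<le> 4" "3 * x\<^sup>2 \<le> 4"
    using zero_le_power2[of "2 * x + y"] zero_le_power2[of "2 * y + x"] by linarith+
  then have "\<bar>y\<bar>\<^sup>2 < 2\<^sup>2" "\<bar>x\<bar>\<^sup>2 < 2\<^sup>2"
    by simp_all
  then have "\<bar>y\<bar> < 2" "\<bar>x\<bar> < 2"
    using power2_less_imp_less zero_le_numeral by blast+
  then have "x \<in> {-1, 0, 1}" "y \<in> {-1, 0, 1}"
    by auto
  then show "(x, y) \<in> dirs"
    using xy by (auto simp: dirs_def)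
qed (auto simp: dirs_def)

lemma dist_pt_one: "dist (pt p) (pt q) = 1 \<longleftrightarrow> q \<in> nb p"
proof -
  define x y where "x = fst q - fst p" and "y = snd q - snd p"
  have "(dist (pt p) (pt q))\<^sup>2 = (of_int x + of_int y / 2)\<^sup>2 + (of_int y * (sqrt 3 / 2))\<^sup>2"
    by (simp add: dist_prod_def pt_def dist_real_def x_def y_def power2_commute algebra_simps)
      (simp add: power2_eq_square algebra_simps add_divide_distrib diff_divide_distrib)
  also have "\<dots> = of_int (x * x + x * y + y * y)"
    by (simp add: power_mult_distrib power_divide) (simp add: power2_eq_square field_simps)
  finally have "(dist (pt p) (pt q))\<^sup>2 = of_int (x * x + x * y + y * y)" .
  moreover have "dist (pt p) (pt q) = 1 \<longleftrightarrow> (dist (pt p) (pt q))\<^sup>2 = 1"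
    using power2_eq_iff_nonneg[of "dist (pt p) (pt q)" 1] by simp
  ultimately have "dist (pt p) (pt q) = 1 \<longleftrightarrow> x * x + x * y + y * y = 1"
    by (simp only: of_int_eq_1_iff)
  then show ?thesis
    unfolding eisenstein_norm_one by (simp add: in_nb_iff x_def y_def minus_prod_def)
qed

lemma tri_edges_iff: "(pt p, w) \<in> tri_edges \<longleftrightarrow> w \<in> pt ` nb p"
  by (auto simp: tri_edges_def tri_verts_eq dist_pt_one)

lemma tri_edges_Image: "tri_edges `` {pt p} = pt ` nb p"
  using tri_edges_iff by blast

section \<open>Transfer of OLD-sets to lattice coordinates and back\<close>

lemma OLD_lattice_vimage:
  assumes "OLD_set tri_verts tri_edges S"
  shows "OLD_lattice (pt -` S)"
proof
  have *: "tri_edges `` {pt p} \<inter> S = pt ` (nb p \<inter> pt -` S)" for p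
    unfolding tri_edges_Image by auto
  fix p :: "int \<times> int"
  show "nb p \<inter> pt -` S \<noteq> {}"
    using assms *[of p] unfolding OLD_set_def tri_verts_eq by (metis image_empty rangeI)
  fix q :: "int \<times> int"
  assume "p \<noteq> q"
  then have "pt p \<noteq> pt q"
    using inj_pt by (simp add: inj_eq)
  then have "pt ` (nb p \<inter> pt -` S) \<noteq> pt ` (nb q \<inter> pt -` S)"
    using assms unfolding OLD_set_def tri_verts_eq *[symmetric] by blast
  then show "nb p \<inter> pt -` S \<noteq> nb q \<inter> pt -` S"
    by metis
qed

lemma OLD_set_image:
  assumes "OLD_lattice L"
  shows "OLD_set tri_verts tri_edges (pt ` L)"
proof -
  interpret OLD_lattice L by fact
  have *: "tri_edges `` {pt p} \<inter> pt ` L = pt ` (nb p \<inter> L)" for p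
    unfolding tri_edges_Image by (simp add: image_Int inj_pt)
  have "pt ` (nb p \<inter> L) \<noteq> pt ` (nb q \<inter> L)" if "pt p \<noteq> pt q" for p q
    using that separating[of p q] by (auto simp: inj_image_eq_iff[OF inj_pt])
  then show ?thesis
    unfolding OLD_set_def tri_verts_eq using dominating * by auto
qed

section \<open>Graph balls as hexagonal balls\<close>

lemma INF_enat_le_iff: "(INF n\<in>A. enat n) \<le> enat k \<longleftrightarrow> (\<exists>n\<in>A. n \<le> k)"
proof -
  \<comment> \<open>A strict bound on an infimum is witnessed by an element, hence the passage from
    \<open>k\<close> to \<open>Suc k\<close>.\<close>
  have "(INF n\<in>A. enat n) \<le> enat k \<longleftrightarrow> (INF n\<in>A. enat n) < enat (Suc k)"
    by (cases "INF n\<in>A. enat n") auto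
  then show ?thesis
    by (auto simp: INF_less_iff less_Suc_eq_le)
qed

lemma hexball_0: "hexball c 0 = {c}"
  by (auto simp: hexball_def hexnorm_def prod_eq_iff)

lemma walk_in_hexball: "(pt c, w) \<in> tri_edges ^^ n \<Longrightarrow> w \<in> pt ` hexball c n"
proof (induction n arbitrary: w)
  case 0
  then show ?case
    by (simp add: hexball_0)
next
  case (Suc n)
  obtain y where y: "(pt c, y) \<in> tri_edges ^^ n" "(y, w) \<in> tri_edges"
    using Suc.prems by (rule relpow_Suc_E)
  obtain p where p: "p \<in> hexball c n" "y = pt p"
    using Suc.IH[OF y(1)] by blast
  then obtain q where "q \<in> nb p" "w = pt q"
    using y(2) unfolding p(2) tri_edges_iff by blast
  then show ?case
    using hexball_nb[OF p(1)] by blast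
qed

lemma hexball_pred:
  assumes "p \<in> hexball c (Suc n)" "p \<notin> hexball c n"
  obtains q where "q \<in> hexball c n" "p \<in> nb q"
proof -
  define x y where "x = fst (p - c)" and "y = snd (p - c)"
  \<comment> \<open>A step pointing outwards in the sector of \<open>p - c\<close>; undoing it
    lowers \<open>hexnorm\<close> by one.\<close>
  define d :: "int \<times> int" where
    "d = (if x > 0 then if y < 0 then (1, -1) else (1, 0)
          else if x = 0 then if y > 0 then (0, 1) else (0, -1)
          else if y > 0 then (-1, 1) else (-1, 0))"
  have "hexnorm (p - c) = int (Suc n)"
    using assms by (auto simp: hexball_def)
  then have "p - d \<in> hexball c n"
    unfolding hexball_def hexnorm_def d_def
    by (auto simp: x_def y_def split: if_splits)
  moreover have "p \<in> nb (p - d)"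
    by (simp add: in_nb_iff d_def dirs_def)
  ultimately show ?thesis
    using that by blast
qed

lemma hexball_walk: "p \<in> hexball c n \<Longrightarrow> \<exists>m\<le>n. (pt c, pt p) \<in> tri_edges ^^ m"
proof (induction n arbitrary: p)
  case 0
  then show ?case
    by (simp add: hexball_0)
next
  case (Suc n)
  show ?case
  proof (cases "p \<in> hexball c n")
    case True
    then show ?thesis
      using Suc.IH le_Suc_eq by blast
  next
    case False
    then obtain q where q: "q \<in> hexball c n" "p \<in> nb q"
      using hexball_pred Suc.prems by blast
    then obtain m where "m \<le> n" "(pt c, pt q) \<in> tri_edges ^^ m"
      using Suc.IH by blast
    moreover have "(pt q, pt p) \<in> tri_edges"
      using q by (simp add: tri_edges_iff)
    ultimately show ?thesis
      by (meson Suc_le_mono relpow_Suc_I)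
  qed
qed

lemma graph_cball_tri: "graph_cball tri_verts tri_edges (pt c) k = pt ` hexball c k"
proof -
  have "pt p \<in> graph_cball tri_verts tri_edges (pt c) k \<longleftrightarrow> p \<in> hexball c k" for p
  proof -
    have "(\<exists>n. (pt c, pt p) \<in> tri_edges ^^ n \<and> n \<le> k) \<longleftrightarrow> p \<in> hexball c k"
    proof
      assume "\<exists>n. (pt c, pt p) \<in> tri_edges ^^ n \<and> n \<le> k"
      then obtain n where "pt p \<in> pt ` hexball c n" "n \<le> k"
        using walk_in_hexball by blast
      then show "p \<in> hexball c k"
        using hexball_mono[of n k c] inj_pt by (auto simp: inj_image_mem_iff)
    qed (use hexball_walk in blast)
    then show ?thesis
      by (simp add: graph_cball_def graph_dist_def tri_verts_eq INF_enat_le_iff)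
  qed
  moreover have "graph_cball tri_verts tri_edges (pt c) k \<subseteq> range pt"
    by (auto simp: graph_cball_def tri_verts_eq)
  ultimately show ?thesis
    by blast
qed

lemma set_density_tri:
  "set_density tri_verts tri_edges S =
     (INF c. limsup (\<lambda>k. ereal (real (card (hexball c k \<inter> pt -` S)) / real (card (hexball c k)))))"
proof -
  have "pt ` hexball c k \<inter> S = pt ` (hexball c k \<inter> pt -` S)" for c k
    by auto
  moreover have "card (pt ` A) = card A" for A
    by (rule card_image[OF inj_on_subset[OF inj_pt subset_UNIV]])
  ultimately show ?thesis
    unfolding set_density_def tri_verts_eq image_image by (simp add: graph_cball_tri[unfolded tri_verts_eq])
qed

section \<open>Density bounds\<close>

lemma OLD_lattice_density_ge:
  assumes "OLD_lattice L"
  shows "ereal (4 / 13) \<le> limsup (\<lambda>k. ereal (real (card (hexball c k \<inter> L)) / real (card (hexball c k))))"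
proof -
  interpret OLD_lattice L by fact
  define b :: "real \<Rightarrow> real" where "b x = 3 * x * x + 3 * x + 1" for x
  have b: "real (card (hexball c k)) = b (real k)" for c k
    by (simp add: card_hexball b_def)
  \<comment> \<open>The bound of \<open>hexball_count\<close> at outer radius \<open>x\<close>, with
    \<open>b\<close> the size of a ball; the leading terms give
    \<open>(4 + 1 - 1) / 13\<close>.\<close>
  define g where "g x = (4 * b (x - 1) + b (x - 2) - b x) / (13 * b x)" for x
  have "g (real k) \<le> real (card (hexball c k \<inter> L)) / real (card (hexball c k))" if "k \<ge> 2" for k
  proof -
    define j where "j = k - 2"
    have k: "k = Suc (Suc j)"
      using that by (simp add: j_def)
    have "real (4 * card (hexball c (Suc j)) + card (hexball c j))
        \<le> real (13 * card (hexball c k \<inter> L) + card (hexball c k))"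
      using hexball_count[of c j] unfolding k by (simp only: of_nat_le_iff)
    then have *: "4 * b (real k - 1) + b (real k - 2) - b (real k) \<le> 13 * real (card (hexball c k \<inter> L))"
      unfolding of_nat_add of_nat_mult b by (simp add: k)
    have "b (real k) > 0"
      by (simp add: b_def add_nonneg_pos)
    then show ?thesis
      using divide_right_mono[OF *, of "13 * b (real k)"] by (simp add: g_def b)
  qed
  then have le: "\<forall>\<^sub>F k in sequentially. ereal (g (real k)) \<le> ereal (real (card (hexball c k \<inter> L)) / real (card (hexball c k)))"
    by (intro eventually_sequentiallyI[of 2]) simp
  have "(\<lambda>k. g (real k)) \<longlonglongrightarrow> 4 / 13"
    unfolding g_def b_def by real_asymp
  then have "ereal (4 / 13) = limsup (\<lambda>k. ereal (g (real k)))"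
    by (intro lim_imp_Limsup[symmetric]) auto
  also have "\<dots> \<le> limsup (\<lambda>k. ereal (real (card (hexball c k \<inter> L)) / real (card (hexball c k))))"
    by (rule Limsup_mono[OF le])
  finally show ?thesis .
qed

text \<open>The error in \<open>card_pattern_hexball\<close> is linear in the radius, while the ball
  grows quadratically.\<close>

lemma pattern_density_le:
  "limsup (\<lambda>k. ereal (real (card (hexball 0 k \<inter> pattern)) / real (card (hexball 0 k)))) \<le> ereal (4 / 13)"
proof -
  define b :: "real \<Rightarrow> real" where "b x = 3 * x * x + 3 * x + 1" for x
  have b: "real (card (hexball 0 k)) = b (real k)" for k
    by (simp add: card_hexball b_def)
  define g where "g x = (4 * b x + 96 * (2 * x + 1)) / (13 * b x)" for x
  have "real (card (hexball 0 k \<inter> pattern)) / real (card (hexball 0 k)) \<le> g (real k)" for k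
  proof -
    have "real (13 * card (hexball 0 k \<inter> pattern)) \<le> real (4 * card (hexball 0 k) + 96 * (2 * k + 1))"
      using card_pattern_hexball by (simp only: of_nat_le_iff)
    then have *: "13 * real (card (hexball 0 k \<inter> pattern)) \<le> 4 * b (real k) + 96 * (2 * real k + 1)"
      unfolding of_nat_add of_nat_mult b by simp
    have "b (real k) > 0"
      by (simp add: b_def add_nonneg_pos)
    then show ?thesis
      using divide_right_mono[OF *, of "13 * b (real k)"] by (simp add: g_def b)
  qed
  then have "limsup (\<lambda>k. ereal (real (card (hexball 0 k \<inter> pattern)) / real (card (hexball 0 k))))
      \<le> limsup (\<lambda>k. ereal (g (real k)))"
    by (intro Limsup_mono) simp
  also have "(\<lambda>k. g (real k)) \<longlonglongrightarrow> 4 / 13"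
    unfolding g_def b_def by real_asymp
  then have "limsup (\<lambda>k. ereal (g (real k))) = ereal (4 / 13)"
    by (intro lim_imp_Limsup) auto
  finally show ?thesis .
qed

theorem theorem1p1:
  "optimal_OLD_density tri_verts tri_edges = 4 / 13 \<and>
   (\<forall>S. OLD_set tri_verts tri_edges S \<longrightarrow> set_density tri_verts tri_edges S \<ge> 4 / 13) \<and>
   (\<exists>S. OLD_set tri_verts tri_edges S \<and> set_density tri_verts tri_edges S = 4 / 13)"
proof -
  have q: "ereal (4 / 13) = 4 / 13"
    by simp
  have lower: "4 / 13 \<le> set_density tri_verts tri_edges S" if "OLD_set tri_verts tri_edges S" for S
    unfolding set_density_tri q[symmetric]
    by (intro INF_greatest OLD_lattice_density_ge OLD_lattice_vimage that)
  have old: "OLD_set tri_verts tri_edges (pt ` pattern)"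
    by (rule OLD_set_image[OF OLD_lattice_pattern])
  have "pt -` pt ` pattern = pattern"
    by (simp add: inj_vimage_image_eq inj_pt)
  \<comment> \<open>\<open>set_density\<close> is an infimum over centers, so an upper bound at the
    origin suffices.\<close>
  then have "set_density tri_verts tri_edges (pt ` pattern) \<le> 4 / 13"
    unfolding set_density_tri q[symmetric] by (intro INF_lower2[of 0]) (use pattern_density_le in simp_all)
  then have dens: "set_density tri_verts tri_edges (pt ` pattern) = 4 / 13"
    using lower[OF old] by (rule antisym)
  have "optimal_OLD_density tri_verts tri_edges = 4 / 13"
  proof (rule antisym)
    show "optimal_OLD_density tri_verts tri_edges \<le> 4 / 13"
      unfolding optimal_OLD_density_def dens[symmetric] by (rule INF_lower) (use old in simp)
    show "4 / 13 \<le> optimal_OLD_density tri_verts tri_edges"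
      unfolding optimal_OLD_density_def by (rule INF_greatest) (use lower in simp)
  qed
  then show ?thesis
    using lower old dens by blast
qed

end
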